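(* Let $r$ be a positive even integer and put $N=r^2-1=(r-1)(r+1)$. Define numbers $a_1,\dots,a_{4N}$ as follows: \[ a_{N}=(-1)^{r/2}\,2\beta^{N},\qquad a_{3N}=(-1)^{(r+2)/2}\,2\beta^{3N}; \] for every index $i\notin\{N,3N\}$ of one of the following forms, \[ a_{(r-1)(4j-3)}=-(r-1)\beta^{(r-1)(4j-3)},\quad a_{(r-1)(4j-1)}=(r-1)\beta^{(r-1)(4j-1)}\quad (j=1,\dots,r+1), \] \[ a_{(r+1)(4j-3)}=-(r+1)\beta^{(r+1)(4j-3)},\quad a_{(r+1)(4j-1)}=(r+1)\beta^{(r+1)(4j-1)}\quad (j=1,\dots,r-1); \] and $a_i=0$ for all other $i\in\{1,\dots,4N\}$. Then \[ \arctan\frac{1}{F_r}=P\bigl(1,\alpha^{4N},4N,(a_1,a_2,\dots,a_{4N})\bigr)=\sum_{k=0}^\infty\frac{1}{\alpha^{4Nk}}\sum_{i=1}^{4N}\frac{a_i}{4Nk+i}. \]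
   Context: $\alpha=(1+\sqrt5)/2$ is the golden ratio and $\beta=-1/\alpha=(1-\sqrt5)/2$. The Fibonacci numbers are $F_n=(\alpha^n-\beta^n)/\sqrt5$. For integers $s,n\ge1$, a number $b$ with $|b|>1$ and a vector $A=(a_1,\dots,a_n)$, the notation $P(s,b,n,A)$ denotes $\sum_{k=0}^\infty b^{-k}\sum_{j=1}^n a_j/(kn+j)^s$. *)

theory Defs
  imports "HOL-Analysis.Analysis" "HOL-Number_Theory.Fib"
begin

definition golden_alpha :: real ("\<alpha>")
  where "\<alpha> = (1 + sqrt 5) / 2"

definition golden_beta :: real ("\<beta>")
  where "\<beta> = (1 - sqrt 5) / 2"

lemma golden_beta_eq: "\<beta> = - 1 / \<alpha>"
proof -
  have "1 + sqrt 5 > (0::real)" by (simp add: add_pos_pos)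
  then show ?thesis
    by (simp add: golden_alpha_def golden_beta_def field_simps)
qed

lemma fib_Binet: "real (fib n) = (\<alpha> ^ n - \<beta> ^ n) / sqrt 5"
  using fib_closed_form[of n] by (simp add: golden_alpha_def golden_beta_def)

text \<open>The vector \<open>A = (a\<^sub>1, \<dots>, a\<^sub>n)\<close> is a function on \<open>nat\<close>; only its values
  on \<open>{1..n}\<close> are used.\<close>

definition BBP_P :: "nat \<Rightarrow> 'a::real_normed_field \<Rightarrow> nat \<Rightarrow> (nat \<Rightarrow> 'a) \<Rightarrow> 'a"
  where "BBP_P s b n A =
    (\<Sum>k. b powi (- int k) * (\<Sum>j=1..n. A j / of_nat (k * n + j) ^ s))"

end

theory Submission
  imports Defs
begin

text \<open>
  For even \<open>r\<close> the numbers \<open>- \<beta> ^ (r \<plusminus> 1)\<close> are positive, their product is \<open>\<beta> ^ (2 * r)\<close>, and the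
  addition formula gives \<open>arctan (1 / F\<^sub>r) = arctan (- \<beta> ^ (r - 1)) + arctan (- \<beta> ^ (r + 1))\<close>.
  Write each Leibniz series as a series in \<open>\<beta> ^ i / i\<close> over all indices \<open>i\<close>. Its coefficient
  depends on \<open>i\<close> only through the character modulo 4 evaluated at \<open>i / (r \<plusminus> 1)\<close>, hence is
  periodic with period \<open>4 * (r - 1) * (r + 1)\<close>. As \<open>r - 1\<close> and \<open>r + 1\<close> are coprime and odd, the
  two series overlap only at odd multiples of \<open>N\<close>; this produces the exceptional values at \<open>N\<close>
  and \<open>3 * N\<close>.
\<close>

section \<open>The character modulo 4 and the Leibniz series\<close>

definition chi4 :: "nat \<Rightarrow> real"
  where "chi4 m = (if m mod 4 = 1 then 1 else if m mod 4 = 3 then - 1 else 0)"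

lemma chi4_odd: "chi4 (2 * n + 1) = (- 1) ^ n"
proof -
  have "(2 * n + 1) mod 4 = (if even n then 1 else 3)"
    by presburger
  then show ?thesis by (simp add: chi4_def)
qed

lemma chi4_even:
  assumes "even m"
  shows "chi4 m = 0"
proof -
  have "m mod 4 \<noteq> 1" "m mod 4 \<noteq> 3" using assms by presburger+
  then show ?thesis by (simp add: chi4_def)
qed

lemma chi4_add_mult4: "chi4 (m + 4 * k) = chi4 m"
  by (simp add: chi4_def)

lemma chi4_mult3: "chi4 (3 * m) = - chi4 m"
proof -
  have "(3 * m) mod 4 = 1 \<longleftrightarrow> m mod 4 = 3" "(3 * m) mod 4 = 3 \<longleftrightarrow> m mod 4 = 1"
    by presburger+
  then show ?thesis by (simp add: chi4_def)
qed

text \<open>The Leibniz term of arctan (x^d) at odd m is \<open>chi4 m\<close> * x^(d*m) / m. With i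
  = d*m the denominator m becomes i / d, whence the factor d.\<close>

definition arctan_coeff :: "nat \<Rightarrow> real \<Rightarrow> nat \<Rightarrow> real"
  where "arctan_coeff d x i = (if d dvd i then real d * chi4 (i div d) * x ^ i else 0)"

lemma arctan_coeff_mult:
  "d > 0 \<Longrightarrow> arctan_coeff d x (d * m) = real d * chi4 m * x ^ (d * m)"
  by (simp add: arctan_coeff_def)

lemma arctan_coeff_nonzeroE:
  assumes "arctan_coeff d x i \<noteq> 0"
  obtains m where "i = d * m" "odd m"
  using assms chi4_even unfolding arctan_coeff_def
  by (metis dvd_mult_div_cancel mult_eq_0_iff)

text \<open>If d divides i, the shift moves i / d by a multiple of 4, which \<open>chi4\<close>
  ignores; otherwise both sides vanish. The free factor e lets two different d share one
  period.\<close>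

lemma arctan_coeff_add_period:
  assumes "d > 0"
  shows "arctan_coeff d x (i + 4 * (d * e) * k) = x ^ (4 * (d * e) * k) * arctan_coeff d x i"
proof (cases "d dvd i")
  case True
  then obtain m where m: "i = d * m" ..
  have "i + 4 * (d * e) * k = d * (m + 4 * (e * k))"
    by (simp add: m algebra_simps)
  then have "arctan_coeff d x (i + 4 * (d * e) * k) = real d * chi4 m * x ^ (i + 4 * (d * e) * k)"
    using assms by (simp add: arctan_coeff_mult chi4_add_mult4)
  also have "\<dots> = x ^ (4 * (d * e) * k) * arctan_coeff d x i"
    using assms by (simp add: m arctan_coeff_mult power_add)
  finally show ?thesis .
next
  case False
  have "4 * (d * e) * k = d * (4 * e * k)" by simp
  then have "\<not> d dvd i + 4 * (d * e) * k"
    using False by (metis dvd_add_left_iff dvd_triv_left)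
  with False show ?thesis by (simp add: arctan_coeff_def)
qed

text \<open>Only odd multiples of d contribute, and in increasing order they give the Leibniz series
  at x^d; inserting zero terms leaves the sum unchanged.\<close>

lemma arctan_coeff_sums:
  assumes "d > 0" "\<bar>x\<bar> \<le> 1"
  shows "(\<lambda>n. arctan_coeff d x (Suc n) / real (Suc n)) sums arctan (x ^ d)"
proof -
  \<comment> \<open>The sum is indexed by \<open>Suc n\<close>, so the n-th odd multiple of d sits
    one position earlier.\<close>
  define g where "g n = d * (2 * n + 1) - 1" for n
  have Suc_g: "Suc (g n) = d * (2 * n + 1)" for n
    using assms(1) by (simp add: g_def)
  have "strict_mono g"
    unfolding strict_mono_def using Suc_g assms(1)
    by (metis Suc_less_eq add_less_cancel_right mult_less_cancel1 zero_less_numeral)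
  moreover have "arctan_coeff d x (Suc n) / real (Suc n) = 0" if "n \<notin> range g" for n
  proof (rule ccontr)
    assume "arctan_coeff d x (Suc n) / real (Suc n) \<noteq> 0"
    then obtain m where "Suc n = d * m" "odd m"
      using arctan_coeff_nonzeroE by (metis div_0)
    then obtain k where "Suc n = d * (2 * k + 1)"
      by (metis oddE)
    then have "n = g k" using Suc_g[of k] by simp
    with that show False by blast
  qed
  moreover have "(\<lambda>n. arctan_coeff d x (Suc (g n)) / real (Suc (g n))) sums arctan (x ^ d)"
  proof -
    have le1: "\<bar>x ^ d\<bar> \<le> 1"
      using assms(2) by (simp add: power_abs power_le_one)
    have "arctan_coeff d x (Suc (g n)) / real (Suc (g n))
        = (- 1) ^ n * (1 / real (n * 2 + 1) * (x ^ d) ^ (n * 2 + 1))" for n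
    proof -
      have "arctan_coeff d x (Suc (g n)) = real d * (- 1) ^ n * (x ^ d) ^ (n * 2 + 1)"
        unfolding Suc_g arctan_coeff_mult[OF assms(1)] chi4_odd
        by (simp only: power_mult mult.commute[of n])
      moreover have "real (Suc (g n)) = real d * real (n * 2 + 1)"
        unfolding Suc_g by (simp only: of_nat_mult mult.commute[of n])
      ultimately show ?thesis using assms(1) by simp
    qed
    with arctan_series[OF le1] summable_arctan_series[OF le1] show ?thesis
      by (simp add: summable_sums)
  qed
  ultimately show ?thesis
    using sums_mono_reindex[of g "\<lambda>n. arctan_coeff d x (Suc n) / real (Suc n)"] by blast
qed

text \<open>Grouping consecutive terms preserves convergence without absolute summability. The
  blocks start at p*k + 1 since there is no term at index 0.\<close>

lemma sums_blocks:
  fixes f :: "nat \<Rightarrow> real"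
  assumes "(\<lambda>n. f (Suc n)) sums S" "p > 0"
  shows "(\<lambda>k. \<Sum>i=1..p. f (p * k + i)) sums S"
proof -
  have "(\<Sum>n=k * p..<k * p + p. f (Suc n)) = (\<Sum>i=1..p. f (p * k + i))" for k
    by (rule sum.reindex_bij_witness[of _ "\<lambda>i. p * k + i - 1" "\<lambda>n. Suc n - p * k"])
       (auto simp: mult.commute)
  with sums_group[OF assms] show ?thesis by simp
qed

section \<open>The golden ratio and the arctangent identity\<close>

lemma abs_golden_beta_less_1: "\<bar>\<beta>\<bar> < 1"
proof -
  have "sqrt 5 < 3" "sqrt 5 > 1" by (auto intro: real_less_lsqrt)
  then show ?thesis by (auto simp: golden_beta_def abs_if)
qed

lemma golden_alpha_pos: "\<alpha> > 0"
  by (simp add: golden_alpha_def add_pos_pos)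

lemma golden_alpha_mult_beta: "\<alpha> * \<beta> = - 1"
  using golden_alpha_pos by (simp add: golden_beta_eq)

text \<open>With u and v the two powers of \<beta>, -u - v = (\<alpha> - \<beta>) \<beta>^r = sqrt 5
  * \<beta>^r and u*v = \<beta>^(2r). Evenness of r gives \<alpha>^r = 1 / \<beta>^r, so Binet's
  formula turns 1 / F_r into the quotient of the addition formula.\<close>

lemma arctan_inverse_fib:
  assumes "r > 0" "even r"
  shows "arctan (1 / real (fib r)) = - arctan (\<beta> ^ (r - 1)) - arctan (\<beta> ^ (r + 1))"
proof -
  define u where "u = \<beta> ^ (r - 1)"
  define v where "v = \<beta> ^ (r + 1)"
  have r1: "r = Suc (r - 1)" using assms by simp
  have br: "\<beta> ^ r = u * \<beta>" by (subst r1) (simp add: u_def)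
  have "\<alpha> ^ r * \<beta> ^ r = 1"
    using assms(2) by (simp flip: power_mult_distrib add: golden_alpha_mult_beta)
  then have bn0: "\<beta> ^ r \<noteq> 0" and ar: "\<alpha> ^ r = 1 / \<beta> ^ r"
    by (metis mult_zero_right zero_neq_one, metis nonzero_eq_divide_eq mult_zero_right zero_neq_one)
  have b0: "\<beta> \<noteq> 0" using golden_alpha_mult_beta by auto
  have ab: "\<alpha> - \<beta> = sqrt 5" by (simp add: golden_alpha_def golden_beta_def field_simps)
  have a: "\<alpha> = - 1 / \<beta>" using golden_alpha_mult_beta b0 by (simp add: field_simps)
  have u: "u = - \<alpha> * \<beta> ^ r" unfolding br a using b0 by simp
  have v: "v = \<beta> * \<beta> ^ r" by (simp add: v_def)
  have uv: "u * v = (\<beta> ^ r)\<^sup>2"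
  proof -
    have "u * v = - (\<alpha> * \<beta>) * (\<beta> ^ r)\<^sup>2"
      unfolding u v by (simp add: power2_eq_square)
    then show ?thesis by (simp add: golden_alpha_mult_beta)
  qed
  have small: "\<bar>\<beta> ^ k\<bar> < 1" if "k > 0" for k
    using abs_golden_beta_less_1 that
    by (simp add: power_abs power_less_one_iff)
  have lt: "(\<beta> ^ r)\<^sup>2 < 1"
    using small[OF assms(1)] by (simp add: abs_square_less_1)
  have bound: "\<bar>u\<bar> < 1" "\<bar>v\<bar> < 1"
  proof -
    \<comment> \<open>Evenness excludes r = 1, where u would be 1.\<close>
    have "r - 1 > 0" using assms by (cases "r = 1") auto
    then show "\<bar>u\<bar> < 1" unfolding u_def by (rule small)
    show "\<bar>v\<bar> < 1" unfolding v_def by (rule small) simp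
  qed
  have sum: "- arctan u - arctan v = arctan ((- u + - v) / (1 - (- u) * (- v)))"
    using arctan_add[of "- u" "- v"] bound by (simp add: arctan_minus)
  have "- u + - v = sqrt 5 * \<beta> ^ r"
    unfolding u v ab[symmetric] by (simp add: algebra_simps)
  moreover have "1 - (- u) * (- v) = 1 - (\<beta> ^ r)\<^sup>2" using uv by simp
  moreover have "1 / real (fib r) = sqrt 5 * \<beta> ^ r / (1 - (\<beta> ^ r)\<^sup>2)"
    unfolding fib_Binet ar using bn0 lt by (simp add: field_simps power2_eq_square)
  ultimately show ?thesis using sum by (simp add: u_def v_def)
qed

section \<open>Index arithmetic: residues modulo 4 and overlaps\<close>

lemma odd_quarter_cases:
  fixes m n :: nat
  assumes "odd m" "m \<le> 4 * n"
  obtains (one) j where "j \<in> {1..n}" "m = 4 * j - 3" "chi4 m = 1"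
    | (three) j where "j \<in> {1..n}" "m = 4 * j - 1" "chi4 m = - 1"
proof -
  have "m mod 4 = 1 \<or> m mod 4 = 3" using assms(1) by presburger
  then show thesis
  proof
    assume *: "m mod 4 = 1"
    then have "m = 4 * (m div 4 + 1) - 3" by presburger
    moreover have "m div 4 + 1 \<in> {1..n}" using assms(2) * by auto presburger
    ultimately show thesis using one[of "m div 4 + 1"] * unfolding chi4_def by argo
  next
    assume *: "m mod 4 = 3"
    then have "m = 4 * (m div 4 + 1) - 1" by presburger
    moreover have "m div 4 + 1 \<in> {1..n}" using assms(2) * by auto presburger
    ultimately show thesis using three[of "m div 4 + 1"] * unfolding chi4_def by force
  qed
qed

text \<open>By coprimality i is a multiple of p*q; it is odd, so the cofactor is odd and at most 4,
  hence 1 or 3.\<close>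

lemma odd_common_multiple_cases:
  fixes p q :: nat
  assumes "coprime p q" "odd p" "p > 0" "q > 0"
    and "i = p * m" "odd m" "i = q * n" "i \<le> 4 * (p * q)"
  shows "i \<in> {p * q, 3 * (p * q)}"
proof -
  have "p dvd i" "q dvd i" using assms(5,7) by (metis dvd_triv_left)+
  then have "p * q dvd i" using assms(1) by (rule divides_mult)
  then obtain l where l: "i = p * q * l" ..
  have "odd i" using assms by simp
  then have "odd l" using l by simp
  moreover have "l \<le> 4"
    using assms(3,4,8) unfolding l by (metis mult.commute mult_le_cancel2 nat_0_less_mult_iff)
  ultimately have "l = 1 \<or> l = 3"
    by presburger
  then show ?thesis using l by auto
qed

section \<open>Identifying the vector and summing the series\<close>

theorem theorem3p5:
  fixes r N :: nat and a :: "nat \<Rightarrow> real"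
  assumes r: "r > 0" "even r"
    and N: "N = r\<^sup>2 - 1"
    and a_N: "a N = (-1) ^ (r div 2) * 2 * \<beta> ^ N"
    and a_3N: "a (3 * N) = (-1) ^ ((r + 2) div 2) * 2 * \<beta> ^ (3 * N)"
    and a_minus_1: "\<And>j. j \<in> {1..r + 1} \<Longrightarrow> (r - 1) * (4 * j - 3) \<notin> {N, 3 * N} \<Longrightarrow>
      a ((r - 1) * (4 * j - 3)) = - (real r - 1) * \<beta> ^ ((r - 1) * (4 * j - 3))"
    and a_minus_3: "\<And>j. j \<in> {1..r + 1} \<Longrightarrow> (r - 1) * (4 * j - 1) \<notin> {N, 3 * N} \<Longrightarrow>
      a ((r - 1) * (4 * j - 1)) = (real r - 1) * \<beta> ^ ((r - 1) * (4 * j - 1))"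
    and a_plus_1: "\<And>j. j \<in> {1..r - 1} \<Longrightarrow> (r + 1) * (4 * j - 3) \<notin> {N, 3 * N} \<Longrightarrow>
      a ((r + 1) * (4 * j - 3)) = - (real r + 1) * \<beta> ^ ((r + 1) * (4 * j - 3))"
    and a_plus_3: "\<And>j. j \<in> {1..r - 1} \<Longrightarrow> (r + 1) * (4 * j - 1) \<notin> {N, 3 * N} \<Longrightarrow>
      a ((r + 1) * (4 * j - 1)) = (real r + 1) * \<beta> ^ ((r + 1) * (4 * j - 1))"
    and a_other: "\<And>i. i \<in> {1..4 * N} \<Longrightarrow> i \<notin> {N, 3 * N} \<Longrightarrow>
      (\<forall>j\<in>{1..r + 1}. i \<noteq> (r - 1) * (4 * j - 3) \<and> i \<noteq> (r - 1) * (4 * j - 1)) \<Longrightarrow>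
      (\<forall>j\<in>{1..r - 1}. i \<noteq> (r + 1) * (4 * j - 3) \<and> i \<noteq> (r + 1) * (4 * j - 1)) \<Longrightarrow>
      a i = 0"
  shows "arctan (1 / real (fib r)) = BBP_P 1 (\<alpha> ^ (4 * N)) (4 * N) a
    \<and> (\<lambda>k. 1 / \<alpha> ^ (4 * N * k) * (\<Sum>i=1..4 * N. a i / real (4 * N * k + i)))
        sums BBP_P 1 (\<alpha> ^ (4 * N)) (4 * N) a"
proof -
  define p where "p = r - 1"
  define q where "q = r + 1"
  obtain h where h: "r = 2 * h" "h > 0" using r by (auto elim!: evenE)
  have pq: "p > 0" "q > 0" "odd p" "odd q" and real_pq: "real p = real r - 1" "real q = real r + 1"
    using h by (cases h; auto simp: p_def q_def)+
  have N_pq: "N = p * q"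
    using r(1) unfolding N p_def q_def
    by (cases r) (simp_all add: power2_eq_square)
  have "gcd p q = 1"
  proof -
    \<comment> \<open>The gcd divides q - p = 2, and it is odd because p is.\<close>
    have "gcd p q dvd 2"
      using r(1) dvd_diff_nat[of "gcd p q" q p] by (simp add: p_def q_def)
    then have "gcd p q \<le> 2" by (rule dvd_imp_le) simp
    moreover have "odd (gcd p q)" using pq(3) by (meson dvd_trans gcd_dvd1)
    ultimately show ?thesis by presburger
  qed
  then have copr: "coprime p q" by (simp add: coprime_iff_gcd_eq_1)
  \<comment> \<open>Since q and p are the consecutive odd numbers 2h + 1 and 2h - 1, their
    characters have opposite signs.\<close>
  have chi_q: "chi4 q = (- 1) ^ h" using chi4_odd[of h] by (simp add: q_def h)
  have chi_p: "chi4 p = - ((- 1) ^ h)"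
  proof -
    have "chi4 (2 * (h - 1) + 1) = (- 1) ^ (h - 1)" by (rule chi4_odd)
    moreover have "2 * (h - 1) + 1 = p" using h by (simp add: p_def)
    moreover have "(- 1 :: real) ^ h = - ((- 1) ^ (h - 1))"
      using h(2) by (cases h) auto
    ultimately show ?thesis by simp
  qed
  have a_eq: "a i = - (arctan_coeff p \<beta> i + arctan_coeff q \<beta> i)" if i: "i \<in> {1..4 * N}" for i
  proof -
    consider "i = N" | "i = 3 * N" | "i \<notin> {N, 3 * N}" by blast
    then show ?thesis
    proof cases
      \<comment> \<open>Both series contribute here: -(p * \<open>chi4 q\<close> + q *
        \<open>chi4 p\<close>) = (q - p) * (-1)^h = 2 * (-1)^h.\<close>
      case 1
      have "arctan_coeff p \<beta> i = real p * chi4 q * \<beta> ^ N"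
        using arctan_coeff_mult[of p \<beta> q] pq 1 N_pq by simp
      moreover have "arctan_coeff q \<beta> i = real q * chi4 p * \<beta> ^ N"
        using arctan_coeff_mult[of q \<beta> p] pq 1 N_pq by (simp add: mult.commute)
      ultimately show ?thesis
        using a_N 1 by (simp add: chi_p chi_q real_pq h algebra_simps)
    next
      \<comment> \<open>Same computation with the sign flipped, as \<open>chi4\<close> of 3 is
        -1.\<close>
      case 2
      have "arctan_coeff p \<beta> i = - real p * chi4 q * \<beta> ^ (3 * N)"
        using arctan_coeff_mult[of p \<beta> "3 * q"] chi4_mult3[of q] pq 2 N_pq
        by (simp add: ac_simps)
      moreover have "arctan_coeff q \<beta> i = - real q * chi4 p * \<beta> ^ (3 * N)"
        using arctan_coeff_mult[of q \<beta> "3 * p"] chi4_mult3[of p] pq 2 N_pq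
        by (simp add: ac_simps)
      ultimately show ?thesis
        using a_3N 2 by (simp add: chi_p chi_q real_pq h algebra_simps)
    next
      case 3
      have i_le: "i \<le> 4 * (p * q)" "i \<le> 4 * (q * p)" using i N_pq by (simp_all add: mult.commute)
      \<comment> \<open>Away from N and 3N at most one of the two coefficients is nonzero.\<close>
      have not_both: False if "i = p * m" "odd m" "i = q * n" for m n
        using odd_common_multiple_cases[OF copr pq(3,1,2) that i_le(1)] 3 N_pq by simp
      show ?thesis
      proof (cases "\<exists>m. i = p * m \<and> odd m")
        case True
        then obtain m where m: "i = p * m" "odd m" by blast
        then have "arctan_coeff q \<beta> i = 0"
          using not_both arctan_coeff_nonzeroE by metis
        moreover have "arctan_coeff p \<beta> i = real p * chi4 m * \<beta> ^ i"
          using arctan_coeff_mult pq m by simp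
        moreover have "a i = - real p * chi4 m * \<beta> ^ i"
        proof -
          \<comment> \<open>This bound puts j into the range 1, ..., r + 1 of the hypotheses on
            \<open>a\<close>.\<close>
          have "m \<le> 4 * q" using i_le m pq by simp
          from m(2) this show ?thesis
          proof (cases rule: odd_quarter_cases)
            case (one j)
            then show ?thesis
              using a_minus_1[of j] 3 m real_pq by (simp add: p_def q_def)
          next
            case (three j)
            then show ?thesis
              using a_minus_3[of j] 3 m real_pq by (simp add: p_def q_def)
          qed
        qed
        ultimately show ?thesis by simp
      next
        case no_p: False
        then have cp: "arctan_coeff p \<beta> i = 0"
          using arctan_coeff_nonzeroE by metis
        show ?thesis
        proof (cases "\<exists>m. i = q * m \<and> odd m")
          case True
          then obtain m where m: "i = q * m" "odd m" by blast
          have "arctan_coeff q \<beta> i = real q * chi4 m * \<beta> ^ i"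
            using arctan_coeff_mult pq m by simp
          moreover have "a i = - real q * chi4 m * \<beta> ^ i"
          proof -
            have "m \<le> 4 * p" using i_le m pq by simp
            from m(2) this show ?thesis
            proof (cases rule: odd_quarter_cases)
              case (one j)
              then show ?thesis
                using a_plus_1[of j] 3 m real_pq by (simp add: p_def q_def)
            next
              case (three j)
              then show ?thesis
                using a_plus_3[of j] 3 m real_pq by (simp add: p_def q_def)
            qed
          qed
          ultimately show ?thesis using cp by simp
        next
          case no_q: False
          then have cq: "arctan_coeff q \<beta> i = 0"
            using arctan_coeff_nonzeroE by metis
          \<comment> \<open>The listed indices are thus odd multiples of p or q, which
            \<open>no_p\<close> and \<open>no_q\<close> exclude. For j = 0 truncated subtraction
            would give 0.\<close>
          have odds: "odd (4 * j - 3)" "odd (4 * j - 1)" if "j \<ge> 1" for j :: nat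
            using that by presburger+
          have "a i = 0"
            using no_p no_q odds
            by (intro a_other[OF i 3]) (metis atLeastAtMost_iff p_def, metis atLeastAtMost_iff q_def)
          with cp cq show ?thesis by simp
        qed
      qed
    qed
  qed

  \<comment> \<open>The coefficients stand in for \<open>a\<close>, whose values are prescribed only
    on the first block; periodicity reduces every block to that one.\<close>
  define f where "f i = - (arctan_coeff p \<beta> i + arctan_coeff q \<beta> i) / real i" for i
  have beta_le: "\<bar>\<beta>\<bar> \<le> 1" using abs_golden_beta_less_1 by simp
  have "(\<lambda>n. f (Suc n)) sums - (arctan (\<beta> ^ p) + arctan (\<beta> ^ q))"
    unfolding f_def
    using sums_minus[OF sums_add[OF arctan_coeff_sums[OF pq(1) beta_le]
        arctan_coeff_sums[OF pq(2) beta_le]]]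
    by (simp add: add_divide_distrib diff_divide_distrib)
  then have "(\<lambda>n. f (Suc n)) sums arctan (1 / real (fib r))"
    using arctan_inverse_fib[OF r] by (simp add: p_def q_def)
  then have blocks: "(\<lambda>k. \<Sum>i=1..4 * N. f (4 * N * k + i)) sums arctan (1 / real (fib r))"
    by (rule sums_blocks) (use pq N_pq in simp)
  \<comment> \<open>The sign in \<beta> = -1 / \<alpha> disappears because the exponent is
    even.\<close>
  have beta_pow: "\<beta> ^ (4 * N * k) = 1 / \<alpha> ^ (4 * N * k)" for k
    by (simp add: golden_beta_eq power_divide)
  have f_block: "f (4 * N * k + i) = 1 / \<alpha> ^ (4 * N * k) * (a i / real (4 * N * k + i))"
    if "i \<in> {1..4 * N}" for k i
  proof -
    have "arctan_coeff p \<beta> (4 * N * k + i) = \<beta> ^ (4 * N * k) * arctan_coeff p \<beta> i"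
      using arctan_coeff_add_period[OF pq(1), of \<beta> i q k] by (simp only: N_pq add.commute)
    moreover have "arctan_coeff q \<beta> (4 * N * k + i) = \<beta> ^ (4 * N * k) * arctan_coeff q \<beta> i"
      using arctan_coeff_add_period[OF pq(2), of \<beta> i p k]
      by (simp only: N_pq add.commute mult.commute[of q p])
    ultimately show ?thesis
      by (simp only: f_def a_eq[OF that] beta_pow[symmetric] distrib_left mult_minus_right
          times_divide_eq_right)
  qed
  have "(\<Sum>i=1..4 * N. f (4 * N * k + i))
      = 1 / \<alpha> ^ (4 * N * k) * (\<Sum>i=1..4 * N. a i / real (4 * N * k + i))" for k
    unfolding sum_distrib_left by (rule sum.cong[OF refl f_block])
  with blocks have series: "(\<lambda>k. 1 / \<alpha> ^ (4 * N * k) * (\<Sum>i=1..4 * N. a i / real (4 * N * k + i)))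
      sums arctan (1 / real (fib r))" by simp
  moreover have "BBP_P 1 (\<alpha> ^ (4 * N)) (4 * N) a
      = (\<Sum>k. 1 / \<alpha> ^ (4 * N * k) * (\<Sum>i=1..4 * N. a i / real (4 * N * k + i)))"
    unfolding BBP_P_def
    by (simp add: power_int_minus power_mult mult.commute[of _ "4 * N"] divide_inverse)
  ultimately show ?thesis by (simp add: sums_iff)
qed

end
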